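(* Let $N\ge 1$, let $\Omega\subset\mathbb{R}^N$ be a bounded domain with boundary $\partial\Omega$ of class $C^2$, and let $\mu\in(0,1)$. Let $a\in C^{\mu}(\overline{\Omega};[0,+\infty))$ satisfy $a\equiv 0$ on $\partial\Omega$ and $a(x)>0$ for all $x\in\Omega$; let $m\in C^{\mu}(\overline{\Omega};\mathbb{R})$; let $g\in C^{1+\mu}(\partial\Omega;[0,+\infty))$ with $g\ge 0$, $g\not\equiv 0$. Let $f\in C^{\mu,1+\mu}(\overline{\Omega}\times[0,+\infty);\mathbb{R})$ satisfy $f(x,0)=0$ for all $x\in\overline\Omega$, $f(x,u)>0$ and $\partial_u f(x,u)>0$ for all $x\in\overline\Omega$ and $u>0$, and, for each $u>0$, $\lim_{k\nearrow+\infty}\frac{f(x,ku)}{k}=+\infty$ uniformly in $x\in\Omega$. Then for each $\lambda\in\mathbb{R}$ there exists an ordered pair $(\underline{u},\overline{u})$ consisting of a subsolution $\underline{u}$ and a positive strict supersolution $\overline{u}$ of the boundary value problem $$\begin{cases}-\Delta u=\lambda m(x)u-a(x)f(x,u) & \text{in }\Omega,\\ u=g(x) & \text{on }\partial\Omega,\end{cases}$$ such that $\underline{u}(x)<\overline{u}(x)$ for all $x\in\Omega$.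
   Context: Sub- and supersolutions are understood in the classical sense. A supersolution of the boundary value problem is a function $\overline{u}\in C^2(\overline{\Omega})$ with $\overline u\ge 0$ such that $-\Delta\overline{u}\ge\lambda m(x)\overline{u}-a(x)f(x,\overline{u})$ in $\Omega$ and $\overline{u}\ge g$ on $\partial\Omega$; it is strict if at least one of these two inequalities is not an identity (i.e. $\overline{u}$ is not a solution), and positive if $\overline{u}>0$ in $\Omega$. A subsolution is a function $\underline{u}\in C^2(\overline{\Omega})$ with $\underline u\ge 0$ satisfying the reversed inequalities $-\Delta\underline{u}\le\lambda m(x)\underline{u}-a(x)f(x,\underline{u})$ in $\Omega$ and $\underline{u}\le g$ on $\partial\Omega$. (Nonnegativity is required because $f(x,\cdot)$ is defined only on $[0,+\infty)$.) The class $C^{\mu,1+\mu}$ means Hölder continuous of exponent $\mu$ in $x$ and of class $C^{1+\mu}$ in $u$. *)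

theory Defs
  imports "HOL-Analysis.Analysis"
begin

definition holder_on :: "real \<Rightarrow> 'a::metric_space set \<Rightarrow> ('a \<Rightarrow> 'b::metric_space) \<Rightarrow> bool"
  where "holder_on \<mu> S u \<longleftrightarrow>
    (\<exists>C. \<forall>x\<in>S. \<forall>y\<in>S. dist (u x) (u y) \<le> C * dist x y powr \<mu>)"

text \<open>
  For open S: u is continuous on the closure of S and twice continuously differentiable in S, with
  gradient and Hessian extending continuously to the closure. The witnesses Du and D2u are only
  tied to u inside S; on the boundary they are the continuous extensions.
  With S = UNIV this is the usual class of twice continuously differentiable functions.
\<close>
definition C2_closure :: "'a::euclidean_space set \<Rightarrow> ('a \<Rightarrow> real) \<Rightarrow> bool"
  where "C2_closure S u \<longleftrightarrow>
    (\<exists>(Du :: 'a \<Rightarrow> 'a) (D2u :: 'a \<Rightarrow> ('a \<Rightarrow>\<^sub>L 'a)).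
       continuous_on (closure S) u \<and> continuous_on (closure S) Du \<and>
       continuous_on (closure S) D2u \<and>
       (\<forall>x\<in>S. GDERIV u x :> Du x \<and> (Du has_derivative blinfun_apply (D2u x)) (at x)))"

definition C1_holder_on :: "real \<Rightarrow> 'a::euclidean_space set \<Rightarrow> ('a \<Rightarrow> real) \<Rightarrow> bool"
  where "C1_holder_on \<mu> S u \<longleftrightarrow>
    (\<exists>Du. (\<forall>x\<in>S. GDERIV u x :> Du x) \<and> holder_on \<mu> S Du)"

definition laplacian :: "('a::euclidean_space \<Rightarrow> real) \<Rightarrow> 'a \<Rightarrow> real"
  where "laplacian u x =
    (\<Sum>b\<in>Basis. frechet_derivative (\<lambda>y. frechet_derivative u (at y) b) (at x) b)"

definition bounded_domain :: "'a::euclidean_space set \<Rightarrow> bool"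
  where "bounded_domain \<Omega> \<longleftrightarrow> open \<Omega> \<and> connected \<Omega> \<and> bounded \<Omega> \<and> \<Omega> \<noteq> {}"

text \<open>Orthogonal projection onto the hyperplane through 0 with unit normal n.\<close>
definition hproj :: "'a::euclidean_space \<Rightarrow> 'a \<Rightarrow> 'a"
  where "hproj n x = x - (x \<bullet> n) *\<^sub>R n"

text \<open>
  Near p the set is the part above the graph of a function of N - 1 variables, with the N-th
  coordinate axis in the direction n. The function h is only evaluated on the hyperplane orthogonal
  to n; requiring it to be C2 on the whole space is no restriction, since a C2 function on
  the hyperplane extends by composition with the projection.
\<close>
definition C2_graph_chart ::
    "'a::euclidean_space set \<Rightarrow> 'a \<Rightarrow> real \<Rightarrow> 'a \<Rightarrow> ('a \<Rightarrow> real) \<Rightarrow> bool"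
  where "C2_graph_chart \<Omega> p r n h \<longleftrightarrow>
    r > 0 \<and> norm n = 1 \<and> C2_closure UNIV h \<and>
    \<Omega> \<inter> ball p r = {x \<in> ball p r. x \<bullet> n > h (hproj n x)}"

definition C2_boundary :: "'a::euclidean_space set \<Rightarrow> bool"
  where "C2_boundary \<Omega> \<longleftrightarrow> (\<forall>p\<in>frontier \<Omega>. \<exists>r n h. C2_graph_chart \<Omega> p r n h)"

text \<open>
  In the local graph coordinates around each boundary point, the boundary function is of class
  C1 with Hoelder continuous gradient. The coordinate expression is again precomposed
  with the projection to the hyperplane. For small d the graph points involved lie on the frontier,
  so values of g off the frontier are irrelevant.
\<close>
definition C1_holder_boundary :: "real \<Rightarrow> 'a::euclidean_space set \<Rightarrow> ('a \<Rightarrow> real) \<Rightarrow> bool"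
  where "C1_holder_boundary \<mu> \<Omega> g \<longleftrightarrow>
    (\<forall>p\<in>frontier \<Omega>. \<exists>r n h d. C2_graph_chart \<Omega> p r n h \<and> d > 0 \<and>
       C1_holder_on \<mu> (ball p d) (\<lambda>y. g (hproj n y + h (hproj n y) *\<^sub>R n)))"

text \<open>
  Hoelder continuous of exponent \<mu> in x and of class C1 with \<mu>-Hoelder derivative in u, the
  constants being uniform for x in the closure and u in bounded intervals. The
  derivative at u = 0 is one-sided.
\<close>
definition holder_C1_holder ::
    "real \<Rightarrow> 'a::euclidean_space set \<Rightarrow> ('a \<Rightarrow> real \<Rightarrow> real) \<Rightarrow> bool"
  where "holder_C1_holder \<mu> \<Omega> f \<longleftrightarrow>
    (\<exists>fu. (\<forall>x\<in>closure \<Omega>. \<forall>u\<ge>0. (f x has_real_derivative fu x u) (at u within {0..})) \<and>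
      (\<forall>M. \<exists>C. \<forall>x\<in>closure \<Omega>. \<forall>y\<in>closure \<Omega>. \<forall>u\<in>{0..M}. \<forall>v\<in>{0..M}.
         \<bar>f x u - f y u\<bar> \<le> C * dist x y powr \<mu> \<and>
         \<bar>fu x u - fu x v\<bar> \<le> C * \<bar>u - v\<bar> powr \<mu>))"

definition supersolution ::
    "'a::euclidean_space set \<Rightarrow> real \<Rightarrow> ('a \<Rightarrow> real) \<Rightarrow> ('a \<Rightarrow> real) \<Rightarrow> ('a \<Rightarrow> real \<Rightarrow> real)
      \<Rightarrow> ('a \<Rightarrow> real) \<Rightarrow> ('a \<Rightarrow> real) \<Rightarrow> bool"
  where "supersolution \<Omega> l m a f g u \<longleftrightarrow>
    C2_closure \<Omega> u \<and> (\<forall>x\<in>closure \<Omega>. u x \<ge> 0) \<and>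
    (\<forall>x\<in>\<Omega>. - laplacian u x \<ge> l * m x * u x - a x * f x (u x)) \<and>
    (\<forall>x\<in>frontier \<Omega>. u x \<ge> g x)"

definition subsolution ::
    "'a::euclidean_space set \<Rightarrow> real \<Rightarrow> ('a \<Rightarrow> real) \<Rightarrow> ('a \<Rightarrow> real) \<Rightarrow> ('a \<Rightarrow> real \<Rightarrow> real)
      \<Rightarrow> ('a \<Rightarrow> real) \<Rightarrow> ('a \<Rightarrow> real) \<Rightarrow> bool"
  where "subsolution \<Omega> l m a f g u \<longleftrightarrow>
    C2_closure \<Omega> u \<and> (\<forall>x\<in>closure \<Omega>. u x \<ge> 0) \<and>
    (\<forall>x\<in>\<Omega>. - laplacian u x \<le> l * m x * u x - a x * f x (u x)) \<and>
    (\<forall>x\<in>frontier \<Omega>. u x \<le> g x)"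

definition strict_supersolution ::
    "'a::euclidean_space set \<Rightarrow> real \<Rightarrow> ('a \<Rightarrow> real) \<Rightarrow> ('a \<Rightarrow> real) \<Rightarrow> ('a \<Rightarrow> real \<Rightarrow> real)
      \<Rightarrow> ('a \<Rightarrow> real) \<Rightarrow> ('a \<Rightarrow> real) \<Rightarrow> bool"
  where "strict_supersolution \<Omega> l m a f g u \<longleftrightarrow>
    supersolution \<Omega> l m a f g u \<and>
    \<not> ((\<forall>x\<in>\<Omega>. - laplacian u x = l * m x * u x - a x * f x (u x)) \<and>
       (\<forall>x\<in>frontier \<Omega>. u x = g x))"

end

theory Submission
  imports Defs
begin

text \<open>
  The zero function is a subsolution, so everything lies in the construction of a positive strict
  supersolution. It is sought as a large multiple \<open>k \<phi>\<close> of a fixed positive \<^emph>\<open>C2\<close> function. The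
  coefficient \<open>a\<close> is bounded below by a positive constant on every compact subset of \<open>\<Omega>\<close>, so there
  the superlinear absorption term \<open>a f(x, k \<phi>)\<close> dominates \<open>k (\<Delta>\<phi> + \<lambda> m \<phi>)\<close> for large \<open>k\<close>. Near the
  boundary \<open>a\<close> degenerates and the absorption is useless; there \<open>\<phi>\<close> itself has to satisfy
  \<open>-\<Delta>\<phi> \<ge> M \<phi>\<close>, where \<open>M\<close> is an upper bound of \<open>\<lambda> m\<close>. By continuity it is enough that
  \<open>-\<Delta>\<phi> > M \<phi>\<close> holds on the boundary. Finally, \<open>k\<close> is also taken so large that \<open>k \<phi> > g\<close> on the
  boundary, where \<open>g\<close> is bounded.

  The barrier \<open>\<phi>\<close> (lemma \<open>ex_barrier\<close>) is obtained without eigenfunctions of thin domains and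
  without the regularity of the distance function. Near a boundary point \<open>p\<close>, a graph chart gives a
  function that vanishes on the nearby part of the boundary and whose gradient does not vanish at \<open>p\<close>; multiplied
  by a cutoff it becomes a global \<^emph>\<open>C2\<close> function \<open>v\<close> that vanishes on the whole boundary
  (lemma \<open>ex_C2_local_defining_function\<close>). Let \<open>w\<close> be the sum of the squares of finitely many such
  functions, chosen by compactness such that at each boundary point some gradient is nonzero
  (lemma \<open>ex_C2_boundary_quadratic\<close>). On the boundary \<open>w\<close> and its gradient vanish, while
  \<open>\<Delta>w = 2 \<Sum> |\<nabla>v|\<^sup>2 > 0\<close>. Squaring is what makes the different charts compatible: the terms add up
  without any comparison of the gradients coming from different charts. Then \<open>\<phi> = exp(-K w)\<close> is
  positive everywhere and has \<open>\<phi> = 1\<close>, \<open>-\<Delta>\<phi> = K \<Delta>w\<close> on the boundary, which exceeds \<open>M\<close> for large \<open>K\<close>.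
\<close>

section \<open>Calculus of twice continuously differentiable functions\<close>

text \<open>
  The gradient and the Hessian are carried along explicitly, since the Laplacians of composite
  functions have to be computed. Everything is global; restriction to a domain comes at the end.
\<close>
definition jet2 :: "('a::euclidean_space \<Rightarrow> real) \<Rightarrow> ('a \<Rightarrow> 'a) \<Rightarrow> ('a \<Rightarrow> ('a \<Rightarrow>\<^sub>L 'a)) \<Rightarrow> bool"
  where "jet2 u Du D2u \<longleftrightarrow>
    (\<forall>x. GDERIV u x :> Du x) \<and> (\<forall>x. (Du has_derivative blinfun_apply (D2u x)) (at x)) \<and>
    continuous_on UNIV D2u"

definition rank_one :: "'a::euclidean_space \<Rightarrow> 'a \<Rightarrow> ('a \<Rightarrow>\<^sub>L 'a)"
  where "rank_one w v = blinfun_scaleR_left w o\<^sub>L blinfun_inner_left v"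

definition blinfun_trace :: "('a::euclidean_space \<Rightarrow>\<^sub>L 'a) \<Rightarrow> real"
  where "blinfun_trace A = (\<Sum>b\<in>Basis. A b \<bullet> b)"

lemma rank_one_apply [simp]: "rank_one w v z = (z \<bullet> v) *\<^sub>R w"
  by (simp add: rank_one_def)

lemma rank_one_zero [simp]: "rank_one 0 v = 0" "rank_one w 0 = 0"
  by (auto intro: blinfun_eqI)

lemma continuous_on_rank_one [continuous_intros]:
  "continuous_on S w \<Longrightarrow> continuous_on S v \<Longrightarrow> continuous_on S (\<lambda>x. rank_one (w x) (v x))"
  unfolding rank_one_def by (intro continuous_intros)

lemma continuous_on_blinfun_trace [continuous_intros]:
  "continuous_on S A \<Longrightarrow> continuous_on S (\<lambda>x. blinfun_trace (A x))"
  unfolding blinfun_trace_def by (intro continuous_intros)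

lemma blinfun_trace_add: "blinfun_trace (A + B) = blinfun_trace A + blinfun_trace B"
  by (simp add: blinfun_trace_def blinfun.add_left inner_add_left sum.distrib)

lemma blinfun_trace_scaleR: "blinfun_trace (c *\<^sub>R A) = c * blinfun_trace A"
  by (simp add: blinfun_trace_def blinfun.scaleR_left sum_distrib_left)

lemma blinfun_trace_sum: "blinfun_trace (\<Sum>i\<in>I. A i) = (\<Sum>i\<in>I. blinfun_trace (A i))"
  unfolding blinfun_trace_def blinfun.sum_left inner_sum_left by (rule sum.swap)

lemma blinfun_trace_rank_one: "blinfun_trace (rank_one w v) = w \<bullet> v"
  unfolding blinfun_trace_def rank_one_apply inner_scaleR_left
  by (subst euclidean_inner) (simp add: inner_commute mult.commute)

lemma jet2D:
  assumes "jet2 u Du D2u"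
  shows "GDERIV u x :> Du x" "(Du has_derivative blinfun_apply (D2u x)) (at x)"
    "continuous_on S u" "continuous_on S Du" "continuous_on S D2u"
proof -
  note * = assms[unfolded jet2_def]
  show "GDERIV u x :> Du x" "(Du has_derivative blinfun_apply (D2u x)) (at x)"
    using * by auto
  show "continuous_on S u" "continuous_on S Du"
    by (rule has_derivative_continuous_on,
        use * in \<open>auto simp: gderiv_def intro: has_derivative_at_withinI\<close>)+
  show "continuous_on S D2u"
    using * continuous_on_subset by blast
qed

lemma jet2_C2_closure:
  assumes "jet2 u Du D2u" shows "C2_closure S u"
  unfolding C2_closure_def using jet2D[OF assms] by blast

lemma C2_closure_UNIV_jet2:
  assumes "C2_closure UNIV u"
  obtains Du D2u where "jet2 u Du D2u"
  using assms unfolding C2_closure_def jet2_def by auto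

lemma jet2_laplacian:
  assumes "jet2 u Du D2u"
  shows "laplacian u x = blinfun_trace (D2u x)"
proof -
  have "frechet_derivative u (at y) = (\<lambda>h. h \<bullet> Du y)" for y
    using jet2D(1)[OF assms, of y] unfolding gderiv_def
    by (metis frechet_derivative_at)
  moreover have "frechet_derivative (\<lambda>y. b \<bullet> Du y) (at x) = (\<lambda>h. b \<bullet> D2u x h)" for b
    by (rule frechet_derivative_at[symmetric])
       (intro has_derivative_inner_right jet2D(2)[OF assms])
  ultimately show ?thesis
    by (simp add: laplacian_def blinfun_trace_def inner_commute)
qed

lemma jet2_add:
  assumes "jet2 u Du D2u" "jet2 v Dv D2v"
  shows "jet2 (\<lambda>x. u x + v x) (\<lambda>x. Du x + Dv x) (\<lambda>x. D2u x + D2v x)"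
  unfolding jet2_def blinfun.add_left
  using jet2D[OF assms(1)] jet2D[OF assms(2)]
  by (auto intro!: GDERIV_add has_derivative_add continuous_intros)

lemma jet2_const: "jet2 (\<lambda>x. c) (\<lambda>x. 0) (\<lambda>x. 0)"
  by (auto simp: jet2_def GDERIV_const intro!: derivative_eq_intros)

lemma jet2_sum:
  assumes "finite I" "\<And>i. i \<in> I \<Longrightarrow> jet2 (u i) (Du i) (D2u i)"
  shows "jet2 (\<lambda>x. \<Sum>i\<in>I. u i x) (\<lambda>x. \<Sum>i\<in>I. Du i x) (\<lambda>x. \<Sum>i\<in>I. D2u i x)"
  using assms by (induction I) (auto intro!: jet2_const jet2_add)

lemma jet2_mult:
  assumes "jet2 u Du D2u" "jet2 v Dv D2v"
  shows "jet2 (\<lambda>x. u x * v x) (\<lambda>x. u x *\<^sub>R Dv x + v x *\<^sub>R Du x)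
    (\<lambda>x. u x *\<^sub>R D2v x + rank_one (Dv x) (Du x) + (v x *\<^sub>R D2u x + rank_one (Du x) (Dv x)))"
  unfolding jet2_def
  using jet2D[OF assms(1)] jet2D[OF assms(2)]
  by (auto intro!: GDERIV_mult continuous_intros derivative_eq_intros
      simp: gderiv_def blinfun.bilinear_simps inner_simps fun_eq_iff algebra_simps)

lemma jet2_compose:
  assumes u: "jet2 u Du D2u"
    and G: "\<And>t. (G has_real_derivative G1 t) (at t)"
    and G1: "\<And>t. (G1 has_real_derivative G2 t) (at t)"
    and G2: "continuous_on UNIV G2"
  shows "jet2 (\<lambda>x. G (u x)) (\<lambda>x. G1 (u x) *\<^sub>R Du x)
    (\<lambda>x. G2 (u x) *\<^sub>R rank_one (Du x) (Du x) + G1 (u x) *\<^sub>R D2u x)"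
proof -
  have c: "continuous_on UNIV G1"
    using G1 by (auto intro: DERIV_continuous_on has_field_derivative_at_within)
  have d: "((\<lambda>x. G1 (u x)) has_derivative (\<lambda>h. (h \<bullet> Du x) * G2 (u x))) (at x)" for x
    using GDERIV_DERIV_compose[OF jet2D(1)[OF u] G1, of x]
    by (simp add: gderiv_def mult.commute)
  show ?thesis
    unfolding jet2_def
    using jet2D[OF u]
    by (auto intro!: GDERIV_DERIV_compose[OF _ G] has_derivative_scaleR[THEN has_derivative_eq_rhs, OF d]
        continuous_intros continuous_on_compose2[OF G2] continuous_on_compose2[OF c]
        simp: blinfun.bilinear_simps fun_eq_iff mult.commute)
qed

lemma jet2_inner: "jet2 (\<lambda>x. x \<bullet> n) (\<lambda>x. n) (\<lambda>x. 0)"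
  by (auto simp: jet2_def gderiv_def intro!: derivative_eq_intros)

text \<open>
  With \<open>s = r\<^sup>2\<close> and \<open>r > 0\<close> this function is positive exactly in the open ball of radius \<open>r\<close> around
  \<open>p\<close>; the cutoff of that ball is the cube of its positive part.
\<close>
lemma jet2_dist_square:
  "jet2 (\<lambda>x. s - (x - p) \<bullet> (x - p)) (\<lambda>x. (- 2) *\<^sub>R (x - p)) (\<lambda>x. (- 2) *\<^sub>R id_blinfun)"
  by (auto simp: jet2_def gderiv_def blinfun.bilinear_simps inner_commute algebra_simps 
    intro!: derivative_eq_intros)

text \<open>
  This form of the projection makes its composition with Hessians a composition of bounded
  linear maps, for which continuity is immediate.
\<close>
lemma hproj_eq_blinfun: "hproj n = blinfun_apply (id_blinfun - rank_one n n)"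
  by (simp add: hproj_def fun_eq_iff blinfun.bilinear_simps)

lemma hproj_selfadjoint: "hproj n x \<bullet> y = x \<bullet> hproj n y"
  by (simp add: hproj_def inner_simps inner_commute)

text \<open>
  Because the projection is linear and self-adjoint, the chain rule multiplies the gradient by it
  once and the Hessian from both sides.
\<close>
lemma jet2_hproj:
  assumes "jet2 h Dh D2h"
  shows "jet2 (\<lambda>x. h (hproj n x)) (\<lambda>x. hproj n (Dh (hproj n x)))
    (\<lambda>x. (id_blinfun - rank_one n n) o\<^sub>L D2h (hproj n x) o\<^sub>L (id_blinfun - rank_one n n))"
proof -
  have P: "(hproj n has_derivative hproj n) F" for F
    unfolding hproj_eq_blinfun by (rule bounded_linear_imp_has_derivative) (rule blinfun.bounded_linear_right)
  have c: "continuous_on UNIV (hproj n)"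
    unfolding hproj_eq_blinfun by (intro continuous_intros)
  have 1: "GDERIV (\<lambda>x. h (hproj n x)) x :> hproj n (Dh (hproj n x))" for x
    unfolding gderiv_def hproj_selfadjoint[symmetric]
    using has_derivative_compose[OF P, of h "\<lambda>z. z \<bullet> Dh (hproj n x)"] jet2D(1)[OF assms, of "hproj n x"]
    by (simp add: gderiv_def)
  have 2: "((\<lambda>x. hproj n (Dh (hproj n x))) has_derivative (\<lambda>z. hproj n (D2h (hproj n x) (hproj n z)))) (at x)" for x
    by (intro has_derivative_compose[OF _ P] has_derivative_compose[OF P] jet2D[OF assms])
  show ?thesis
    unfolding jet2_def
    using 1 2 continuous_on_compose2[OF jet2D(5)[OF assms, of UNIV] c]
    by (auto intro!: continuous_intros simp: hproj_eq_blinfun blinfun_compose.rep_eq o_def)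
qed

section \<open>Local defining functions of the boundary\<close>

text \<open>
  Every power of the positive part from the square on is differentiable also at 0, since its
  difference quotient there is at most \<open>\<bar>h\<bar> ^ (n + 1)\<close>. Hence the cube is twice continuously
  differentiable and can be used as a cutoff.
\<close>
lemma DERIV_pos_part_power:
  "((\<lambda>t::real. max 0 t ^ (n+2)) has_real_derivative (real n+2) * max 0 t ^ (n+1)) (at t)"
proof (cases t "0::real" rule: linorder_cases)
  case less
  have "((\<lambda>t::real. 0) has_real_derivative 0) (at t)" by simp
  then have "((\<lambda>t::real. max 0 t ^ (n+2)) has_real_derivative 0) (at t)"
    by (rule has_field_derivative_transform_within_open[where S="{..<0}"]) (use less in auto)
  then show ?thesis using less by simp
next
  case greater
  have "((\<lambda>t::real. t^(n+2)) has_real_derivative (real n + 2) * t^(n+1)) (at t)"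
    by (rule DERIV_cong[OF DERIV_pow]) simp
  then have "((\<lambda>t::real. max 0 t ^ (n+2)) has_real_derivative (real n + 2) * t^(n+1)) (at t)"
    by (rule has_field_derivative_transform_within_open[where S="{0<..}"]) (use greater in auto)
  then show ?thesis using greater by simp
next
  case equal
  have "((\<lambda>h::real. max 0 h ^ (n+2) / h) \<longlongrightarrow> 0) (at 0)"
  proof (rule tendsto_rabs_zero_cancel, rule tendsto_sandwich)
    show "\<forall>\<^sub>F h in at 0. 0 \<le> \<bar>max 0 h ^ (n+2) / h :: real\<bar>" by (intro always_eventually allI abs_ge_zero)
    show "\<forall>\<^sub>F h in at 0. \<bar>max 0 h ^ (n+2) / h\<bar> \<le> \<bar>h::real\<bar> ^ (n+1)"
      by (intro always_eventually allI) (auto simp: max_def mult_nonpos_nonneg)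
    show "((\<lambda>h::real. \<bar>h\<bar> ^ (n+1)) \<longlongrightarrow> 0) (at 0)"
      by (auto intro!: tendsto_eq_intros)
  qed simp
  then show ?thesis using equal by (simp add: DERIV_def)
qed

lemma ex_C2_bump:
  assumes "r > 0"
  obtains \<eta> D\<eta> D2\<eta> where "jet2 \<eta> D\<eta> D2\<eta>" "\<eta> p > 0" "\<And>x. x \<notin> ball p r \<Longrightarrow> \<eta> x = 0"
proof
  let ?q = "\<lambda>x. r\<^sup>2 - (x - p) \<bullet> (x - p)"
  have G1: "((\<lambda>t::real. 3 * max 0 t ^ 2) has_real_derivative 6 * max 0 t) (at t)" for t
    using DERIV_cmult[OF DERIV_pos_part_power[of 0 t], of 3] by (simp add: power2_eq_square)
  have G: "((\<lambda>t::real. max 0 t ^ 3) has_real_derivative 3 * max 0 t ^ 2) (at t)" for t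
    using DERIV_pos_part_power[of 1 t] by (simp add: numeral_eq_Suc)
  show "jet2 (\<lambda>x. max 0 (?q x) ^ 3) (\<lambda>x. (3 * max 0 (?q x) ^ 2) *\<^sub>R ((- 2) *\<^sub>R (x - p)))
     (\<lambda>x. (6 * max 0 (?q x)) *\<^sub>R rank_one ((- 2) *\<^sub>R (x - p)) ((- 2) *\<^sub>R (x - p)) +
          (3 * max 0 (?q x) ^ 2) *\<^sub>R ((- 2) *\<^sub>R id_blinfun))"
    by (rule jet2_compose[OF jet2_dist_square G G1]) (intro continuous_intros)
  show "max 0 (?q p) ^ 3 > 0" using assms by simp
  show "max 0 (?q x) ^ 3 = 0" if "x \<notin> ball p r" for x
  proof -
    have "r\<^sup>2 \<le> (norm (x - p))\<^sup>2"
      using that assms by (intro power_mono) (auto simp: dist_norm norm_minus_commute)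
    then show ?thesis by (simp add: power2_norm_eq_inner max_def)
  qed
qed

text \<open>
  Strictly above the graph lies an open subset of \<open>\<Omega>\<close>, and strictly below it an open set disjoint
  from \<open>\<Omega>\<close>; neither can contain a boundary point.
\<close>
lemma frontier_in_graph:
  assumes "C2_graph_chart \<Omega> p r n h" "x \<in> frontier \<Omega>" "x \<in> ball p r"
  shows "x \<bullet> n = h (hproj n x)"
proof -
  have eq: "\<Omega> \<inter> ball p r = {x \<in> ball p r. x \<bullet> n > h (hproj n x)}"
    using assms(1) by (simp add: C2_graph_chart_def)
  obtain Dh D2h where "jet2 h Dh D2h"
    using assms(1) C2_closure_UNIV_jet2 unfolding C2_graph_chart_def by metis
  then have c: "continuous_on UNIV (\<lambda>x. h (hproj n x))"
    using jet2D(3) jet2_hproj by blast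
  have o1: "open ({x. x \<bullet> n > h (hproj n x)} \<inter> ball p r)"
    by (intro open_Int open_Collect_less c continuous_intros open_ball)
  have o2: "open ({x. x \<bullet> n < h (hproj n x)} \<inter> ball p r)"
    by (intro open_Int open_Collect_less c continuous_intros open_ball)
  have "\<not> x \<bullet> n > h (hproj n x)"
  proof
    assume "x \<bullet> n > h (hproj n x)"
    moreover have "{x. x \<bullet> n > h (hproj n x)} \<inter> ball p r \<subseteq> \<Omega>" using eq by auto
    ultimately have "x \<in> interior \<Omega>"
      using assms(3) by (intro interiorI[OF o1]) auto
    then show False using assms(2) by (simp add: frontier_def)
  qed
  moreover have "\<not> x \<bullet> n < h (hproj n x)"
  proof
    assume *: "x \<bullet> n < h (hproj n x)"
    have "\<Omega> \<inter> ({x. x \<bullet> n < h (hproj n x)} \<inter> ball p r) = {}" using eq by force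
    then have "closure \<Omega> \<inter> ({x. x \<bullet> n < h (hproj n x)} \<inter> ball p r) = {}"
      using open_Int_closure_eq_empty[OF o2] by auto
    then show False using * assms(2,3) by (auto simp: frontier_def)
  qed
  ultimately show ?thesis by simp
qed

text \<open>
  The function is a cutoff times the height \<open>x \<bullet> n - h(x)\<close> above the graph. The height vanishes on
  the boundary inside the ball of the chart and the cutoff vanishes outside. At \<open>p\<close> the gradient of
  the product is \<open>\<eta>(p)\<close> times that of the height, which has component 1 along \<open>n\<close> because the
  gradient of \<open>h\<close> composed with the projection is orthogonal to \<open>n\<close>.
\<close>
lemma ex_C2_local_defining_function:
  assumes chart: "C2_graph_chart \<Omega> p r n h" and p: "p \<in> frontier \<Omega>"
  obtains v Dv D2v where "jet2 v Dv D2v" "\<And>x. x \<in> frontier \<Omega> \<Longrightarrow> v x = 0" "Dv p \<noteq> 0"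
proof -
  have r: "r > 0" and n: "norm n = 1" and h: "C2_closure UNIV h"
    using chart by (auto simp: C2_graph_chart_def)
  obtain Dh D2h where h: "jet2 h Dh D2h" using C2_closure_UNIV_jet2[OF h] .
  obtain \<eta> D\<eta> D2\<eta> where \<eta>: "jet2 \<eta> D\<eta> D2\<eta>" "\<eta> p > 0" "\<And>x. x \<notin> ball p r \<Longrightarrow> \<eta> x = 0"
    using ex_C2_bump[OF r] by metis
  \<comment> \<open>The height is written as a sum and a product to match the rules for jets.\<close>
  define \<rho> where "\<rho> x = x \<bullet> n + (-1) * h (hproj n x)" for x
  obtain D\<rho> D2\<rho> where \<rho>: "jet2 \<rho> D\<rho> D2\<rho>" and D\<rho>: "\<And>x. D\<rho> x = n - hproj n (Dh (hproj n x))"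
    using jet2_add[OF jet2_inner[of n] jet2_mult[OF jet2_const[of "-1"] jet2_hproj[OF h, of n]]]
    unfolding \<rho>_def by fastforce
  have \<rho>0: "\<rho> x = 0" if "x \<in> frontier \<Omega>" "x \<in> ball p r" for x
    using frontier_in_graph[OF chart that] by (simp add: \<rho>_def)
  have "D\<rho> p \<bullet> n = 1"
    using n by (simp add: D\<rho> hproj_def inner_simps norm_eq_1)
  then have "D\<rho> p \<noteq> 0" by auto
  moreover have "\<rho> p = 0" using \<rho>0 p r by simp
  ultimately have "\<eta> p *\<^sub>R D\<rho> p + \<rho> p *\<^sub>R D\<eta> p \<noteq> 0" using \<eta>(2) by simp
  moreover have "\<eta> x * \<rho> x = 0" if "x \<in> frontier \<Omega>" for x
    using \<rho>0[OF that] \<eta>(3) by (cases "x \<in> ball p r") auto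
  ultimately show ?thesis using that[OF jet2_mult[OF \<eta>(1) \<rho>]] by blast
qed

section \<open>The barrier\<close>

text \<open>
  A substitute for the squared distance to the boundary: the sum of the squares of finitely many
  local defining functions. Where such a function \<open>v\<close> vanishes, the Laplacian of its square is
  \<open>2 |\<nabla>v|\<^sup>2\<close>, so no cancellation can occur in the sum.
\<close>
lemma ex_C2_boundary_quadratic:
  assumes \<Omega>: "C2_boundary \<Omega>" and bd: "bounded \<Omega>"
  obtains w Dw D2w where "jet2 w Dw D2w"
    "\<And>x. x \<in> frontier \<Omega> \<Longrightarrow> w x = 0 \<and> Dw x = 0 \<and> blinfun_trace (D2w x) > 0"
proof -
  have "\<exists>v Dv D2v. jet2 v Dv D2v \<and> (\<forall>x\<in>frontier \<Omega>. v x = 0) \<and> Dv p \<noteq> 0"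
    if "p \<in> frontier \<Omega>" for p
    using \<Omega> that unfolding C2_boundary_def by (metis ex_C2_local_defining_function)
  then obtain v Dv D2v where v: "\<And>p. p \<in> frontier \<Omega> \<Longrightarrow>
      jet2 (v p) (Dv p) (D2v p) \<and> (\<forall>x\<in>frontier \<Omega>. v p x = 0) \<and> Dv p p \<noteq> (0::'a)"
    by metis
  have cpt: "compact (frontier \<Omega>)" using bd by (rule compact_frontier_bounded)
  have op: "open {x. Dv p x \<noteq> 0}" if "p \<in> frontier \<Omega>" for p
    using v[OF that] jet2D(4) by (intro open_Collect_neq) (auto intro: continuous_intros)
  obtain I where I: "I \<subseteq> frontier \<Omega>" "finite I" "frontier \<Omega> \<subseteq> (\<Union>p\<in>I. {x. Dv p x \<noteq> 0})"
    by (rule compactE_image[OF cpt, of "frontier \<Omega>" "\<lambda>p. {x. Dv p x \<noteq> 0}"])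
       (use op v in auto)
  note j = jet2_sum[OF I(2) jet2_mult, of v Dv D2v v Dv D2v]
  show ?thesis
  proof (rule that[OF j])
    show "jet2 (v i) (Dv i) (D2v i)" if "i \<in> I" for i using that I v by auto
    fix x assume x: "x \<in> frontier \<Omega>"
    have v0: "v i x = 0" if "i \<in> I" for i using that I v x by auto
    have "(\<Sum>i\<in>I. 2 * (Dv i x \<bullet> Dv i x)) > 0"
    proof -
      obtain i where "i \<in> I" "Dv i x \<noteq> 0" using I(3) x by auto
      then show ?thesis using I(2) by (intro sum_pos2[of _ i]) auto
    qed
    then show "(\<Sum>i\<in>I. v i x * v i x) = 0 \<and>
      (\<Sum>i\<in>I. v i x *\<^sub>R Dv i x + v i x *\<^sub>R Dv i x) = 0 \<and>
      0 < blinfun_trace (\<Sum>i\<in>I. v i x *\<^sub>R D2v i x + rank_one (Dv i x) (Dv i x) +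
              (v i x *\<^sub>R D2v i x + rank_one (Dv i x) (Dv i x)))"
      by (simp add: v0 blinfun_trace_sum blinfun_trace_add blinfun_trace_rank_one)
  qed (use I v in auto)
qed

text \<open>
  Take \<open>\<phi> = exp(-K w)\<close> with \<open>w\<close> from the preceding lemma. In general
  \<open>\<Delta>\<phi> = (K\<^sup>2 |\<nabla>w|\<^sup>2 - K \<Delta>w) \<phi>\<close>; on the boundary the term with the wrong sign vanishes, and the other
  one is as large as desired because \<open>\<Delta>w\<close> is bounded below there by a positive constant.
\<close>
lemma ex_barrier:
  assumes \<Omega>: "C2_boundary \<Omega>" and bd: "bounded \<Omega>"
  obtains \<phi> D\<phi> D2\<phi> where "jet2 \<phi> D\<phi> D2\<phi>" "\<And>x. \<phi> x > 0"
    "\<And>x. x \<in> frontier \<Omega> \<Longrightarrow> - blinfun_trace (D2\<phi> x) > M * \<phi> x"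
proof -
  obtain w Dw D2w where w: "jet2 w Dw D2w"
    and w0: "\<And>x. x \<in> frontier \<Omega> \<Longrightarrow> w x = 0 \<and> Dw x = 0 \<and> blinfun_trace (D2w x) > 0"
    using ex_C2_boundary_quadratic[OF assms] by metis
  obtain K where K: "\<And>x. x \<in> frontier \<Omega> \<Longrightarrow> K * blinfun_trace (D2w x) > M"
  proof (cases "frontier \<Omega> = {}")
    case True then show ?thesis using that by auto
  next
    case False
    have "continuous_on (frontier \<Omega>) (\<lambda>x. blinfun_trace (D2w x))"
      by (intro continuous_intros jet2D(5)[OF w])
    then obtain z where z: "z \<in> frontier \<Omega>"
      "\<And>x. x \<in> frontier \<Omega> \<Longrightarrow> blinfun_trace (D2w z) \<le> blinfun_trace (D2w x)"
      using continuous_attains_inf[OF compact_frontier_bounded[OF bd] False] by metis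
    let ?c = "blinfun_trace (D2w z)"
    have c: "?c > 0" using w0 z by auto
    show ?thesis
    proof (rule that[of "(\<bar>M\<bar> + 1) / ?c"])
      fix x assume "x \<in> frontier \<Omega>"
      then have "(\<bar>M\<bar> + 1) / ?c * ?c \<le> (\<bar>M\<bar> + 1) / ?c * blinfun_trace (D2w x)"
        using z c by (intro mult_left_mono) auto
      then show "M < (\<bar>M\<bar> + 1) / ?c * blinfun_trace (D2w x)" using c by auto
    qed
  qed
  note j = jet2_compose[OF w, of "\<lambda>t. exp (- K * t)" "\<lambda>t. - K * exp (- K * t)" "\<lambda>t. K\<^sup>2 * exp (- K * t)"]
  show ?thesis
  proof (rule that[OF j])
    fix x assume x: "x \<in> frontier \<Omega>"
    show "M * exp (- K * w x) < - blinfun_trace ((K\<^sup>2 * exp (- K * w x)) *\<^sub>R rank_one (Dw x) (Dw x) +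
              (- K * exp (- K * w x)) *\<^sub>R D2w x)"
      unfolding blinfun_trace_add blinfun_trace_scaleR blinfun_trace_rank_one
      using w0[OF x] K[OF x] by simp
  qed (auto intro!: derivative_eq_intros continuous_intros simp: power2_eq_square)
qed

section \<open>Consequences of the regularity assumptions on the data\<close>

lemma holder_on_continuous_on:
  assumes "holder_on \<mu> S u" "\<mu> > 0"
  shows "continuous_on S u"
  unfolding continuous_on_def
proof
  fix x assume x: "x \<in> S"
  obtain C where C: "\<And>x y. x \<in> S \<Longrightarrow> y \<in> S \<Longrightarrow> dist (u x) (u y) \<le> C * dist x y powr \<mu>"
    using assms(1) unfolding holder_on_def by blast
  have "((\<lambda>y. C * dist y x powr \<mu>) \<longlongrightarrow> C * dist x x powr \<mu>) (at x within S)"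
    using assms(2) by (intro tendsto_intros tendsto_powr') auto
  then have "((\<lambda>y. C * dist y x powr \<mu>) \<longlongrightarrow> 0) (at x within S)" by simp
  then have "((\<lambda>y. dist (u y) (u x)) \<longlongrightarrow> 0) (at x within S)"
    by (rule tendsto_0_le[where K=1])
       (use C x in \<open>auto simp: eventually_at_filter intro!: always_eventually order_trans[OF _ abs_ge_self]\<close>)
  then show "(u \<longlongrightarrow> u x) (at x within S)" by (rule iffD2[OF tendsto_dist_iff])
qed

text \<open>
  Near a boundary point \<open>g\<close> agrees on the boundary with its expression in the chart, which is
  differentiable.
\<close>
lemma C1_holder_boundary_continuous:
  assumes "C1_holder_boundary \<mu> \<Omega> g"
  shows "continuous_on (frontier \<Omega>) g"
  unfolding continuous_on_eq_continuous_within
proof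
  fix p assume p: "p \<in> frontier \<Omega>"
  obtain r n h d where ch: "C2_graph_chart \<Omega> p r n h" and d: "d > 0"
    and g: "C1_holder_on \<mu> (ball p d) (\<lambda>y. g (hproj n y + h (hproj n y) *\<^sub>R n))"
    using assms p unfolding C1_holder_boundary_def by blast
  let ?G = "\<lambda>y. g (hproj n y + h (hproj n y) *\<^sub>R n)"
  have r: "r > 0" using ch by (simp add: C2_graph_chart_def)
  have "isCont ?G p"
  proof -
    obtain DG where "(?G has_derivative (\<lambda>z. z \<bullet> DG p)) (at p)"
      using g d unfolding C1_holder_on_def gderiv_def by (meson centre_in_ball)
    then show ?thesis by (rule has_derivative_continuous)
  qed
  then have "continuous (at p within frontier \<Omega>) ?G"
    by (rule continuous_at_imp_continuous_at_within)
  then show "continuous (at p within frontier \<Omega>) g"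
  proof (rule continuous_transform_within[OF _ r p])
    fix x assume "x \<in> frontier \<Omega>" "dist x p < r"
    then have "x \<bullet> n = h (hproj n x)"
      using frontier_in_graph[OF ch] by (simp add: dist_commute)
    then show "?G x = g x" by (simp add: hproj_def flip: \<open>x \<bullet> n = h (hproj n x)\<close>)
  qed
qed

lemma continuous_on_compact_le:
  fixes u :: "'a::topological_space \<Rightarrow> real"
  assumes "compact S" "continuous_on S u"
  obtains B where "\<And>x. x \<in> S \<Longrightarrow> u x \<le> B"
proof -
  have "bdd_above (u ` S)"
    using assms by (intro bounded_imp_bdd_above compact_imp_bounded compact_continuous_image)
  then show ?thesis using that by (auto simp: bdd_above_def)
qed

text \<open>
  The assumed derivative is relative to \<open>[0, \<infinity>)\<close>; at positive arguments it is two-sided and hence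
  agrees with \<open>deriv\<close>.
\<close>
lemma mono_of_deriv_pos:
  assumes f: "holder_C1_holder \<mu> \<Omega> f" and x: "x \<in> closure \<Omega>"
    and pos: "\<And>u. u > 0 \<Longrightarrow> deriv (f x) u > 0"
    and uv: "0 < u" "u \<le> v"
  shows "f x u \<le> f x v"
proof (rule DERIV_nonneg_imp_nondecreasing[OF uv(2)])
  fix t assume "u \<le> t"
  then have t: "t > 0" using uv by simp
  obtain d where "(f x has_real_derivative d) (at t within {0..})"
    using f x less_imp_le[OF t] unfolding holder_C1_holder_def by meson
  moreover have "at t within {0..} = at t"
    using t by (intro at_within_interior) auto
  ultimately have "(f x has_real_derivative d) (at t)" by simp
  moreover from this have "d = deriv (f x) t" by (simp add: DERIV_imp_deriv)
  ultimately show "\<exists>y. (f x has_real_derivative y) (at t) \<and> 0 \<le> y"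
    using pos[OF t] by auto
qed

section \<open>Existence of an ordered pair of a sub- and a supersolution\<close>

theorem theorem2p1:
  fixes \<Omega> :: "'a::euclidean_space set"
    and \<mu> :: real
    and a m g :: "'a \<Rightarrow> real"
    and f :: "'a \<Rightarrow> real \<Rightarrow> real"
  assumes "bounded_domain \<Omega>"
    and "C2_boundary \<Omega>"
    and "0 < \<mu>" and "\<mu> < 1"
    and "holder_on \<mu> (closure \<Omega>) a"
    and "\<forall>x\<in>closure \<Omega>. a x \<ge> 0"
    and "\<forall>x\<in>frontier \<Omega>. a x = 0"
    and "\<forall>x\<in>\<Omega>. a x > 0"
    and "holder_on \<mu> (closure \<Omega>) m"
    and "C1_holder_boundary \<mu> \<Omega> g"
    and "\<forall>x\<in>frontier \<Omega>. g x \<ge> 0"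
    and "\<exists>x\<in>frontier \<Omega>. g x \<noteq> 0"
    and "holder_C1_holder \<mu> \<Omega> f"
    and "\<forall>x\<in>closure \<Omega>. f x 0 = 0"
    and "\<forall>x\<in>closure \<Omega>. \<forall>u>0. f x u > 0 \<and> deriv (f x) u > 0"
    and "\<forall>u>0. \<forall>B. eventually (\<lambda>k. \<forall>x\<in>\<Omega>. f x (k * u) / k \<ge> B) at_top"
  shows "\<forall>l::real. \<exists>u_sub u_sup.
           subsolution \<Omega> l m a f g u_sub \<and>
           strict_supersolution \<Omega> l m a f g u_sup \<and>
           (\<forall>x\<in>\<Omega>. u_sup x > 0) \<and>
           (\<forall>x\<in>\<Omega>. u_sub x < u_sup x)"
proof
  fix l :: real
  have bd: "bounded \<Omega>" and op: "open \<Omega>" and ne: "\<Omega> \<noteq> {}"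
    using assms(1) by (auto simp: bounded_domain_def)
  have cpt: "compact (closure \<Omega>)" using bd by (simp add: compact_closure)
  have fr: "closure \<Omega> = \<Omega> \<union> frontier \<Omega>" "\<Omega> \<inter> frontier \<Omega> = {}"
    using op closure_subset by (auto simp: frontier_def interior_open)
  have ca: "continuous_on (closure \<Omega>) a" and cm: "continuous_on (closure \<Omega>) m"
    using assms by (auto intro: holder_on_continuous_on)
  obtain M where M: "\<And>x. x \<in> closure \<Omega> \<Longrightarrow> l * m x \<le> M"
    using continuous_on_compact_le[OF cpt continuous_on_mult_left[OF cm]] by metis
  obtain B where B: "\<And>x. x \<in> frontier \<Omega> \<Longrightarrow> g x \<le> B"
    using continuous_on_compact_le[OF compact_frontier_bounded[OF bd]
        C1_holder_boundary_continuous[OF assms(10)]] by metis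
  obtain \<phi> D\<phi> D2\<phi> where \<phi>: "jet2 \<phi> D\<phi> D2\<phi>" and \<phi>_pos: "\<And>x. \<phi> x > 0"
    and \<phi>_frontier: "\<And>x. x \<in> frontier \<Omega> \<Longrightarrow> - blinfun_trace (D2\<phi> x) > M * \<phi> x"
    using ex_barrier[OF assms(2) bd] by metis
  have c\<phi>: "continuous_on S \<phi>" for S by (rule jet2D(3)[OF \<phi>])
  obtain c where c: "c > 0" "\<And>x. x \<in> closure \<Omega> \<Longrightarrow> c \<le> \<phi> x"
    using continuous_attains_inf[OF cpt _ c\<phi>] ne \<phi>_pos by (metis closure_eq_empty)
  \<comment> \<open>Where \<open>F < 0\<close> the barrier needs no help from the absorption. The points with \<open>F \<ge> 0\<close> form a
    compact set \<open>K\<close> that avoids the boundary, so \<open>a\<close> is bounded below by a positive constant on \<open>K\<close>.\<close>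
  define F where "F x = M * \<phi> x + blinfun_trace (D2\<phi> x)" for x
  have cF: "continuous_on S F" for S
    unfolding F_def by (intro continuous_intros c\<phi> jet2D(5)[OF \<phi>])
  define K where "K = closure \<Omega> \<inter> {x. F x \<ge> 0}"
  have K\<Omega>: "K \<subseteq> \<Omega>"
    using \<phi>_frontier fr by (force simp: K_def F_def)
  have "compact K"
    unfolding K_def using cF by (intro compact_Int_closed cpt closed_Collect_le) auto
  have a: "\<exists>a0>0. \<forall>x\<in>K. a0 \<le> a x"
  proof (cases "K = {}")
    case False
    then show ?thesis
      using continuous_attains_inf[OF \<open>compact K\<close> False, of a] ca assms(8) K\<Omega> fr(1)
      by (metis continuous_on_subset subsetD sup.coboundedI1)
  qed (auto intro: exI[of _ 1])
  then obtain a0 where a0: "a0 > 0" "\<And>x. x \<in> K \<Longrightarrow> a0 \<le> a x" by auto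
  obtain B1 where B1: "\<And>x. x \<in> closure \<Omega> \<Longrightarrow> F x \<le> B1"
    using continuous_on_compact_le[OF cpt cF] by metis
  \<comment> \<open>The bound \<open>k > B / c\<close> gives \<open>k \<phi> > g\<close> on the boundary, and so strictness. The other one lets the
    absorption outweigh \<open>k F\<close> on \<open>K\<close>; it is stated at the constant \<open>c \<le> \<phi>\<close>, where the growth of \<open>f\<close>
    is uniform in \<open>x\<close>, and monotonicity of \<open>f\<close> carries it over to \<open>\<phi>\<close>.\<close>
  have "\<forall>\<^sub>F k in at_top. k > max 0 (B / c) \<and> (\<forall>x\<in>\<Omega>. f x (k * c) / k \<ge> B1 / a0)"
    using assms(16) c(1) by (intro eventually_conj eventually_gt_at_top) auto
  then have "\<exists>k. k > max 0 (B / c) \<and> (\<forall>x\<in>\<Omega>. f x (k * c) / k \<ge> B1 / a0)"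
    by (rule eventually_happens'[rotated]) simp
  then obtain k where k: "k > 0" "k > B / c" "\<And>x. x \<in> \<Omega> \<Longrightarrow> f x (k * c) / k \<ge> B1 / a0"
    by auto
  define u where "u x = k * \<phi> x" for x
  obtain Du where u: "jet2 u Du (\<lambda>x. k *\<^sub>R D2\<phi> x)"
    using jet2_mult[OF jet2_const[of k] \<phi>] by (auto simp: u_def[abs_def])
  have lap: "laplacian u x = k * blinfun_trace (D2\<phi> x)" for x
    by (simp add: jet2_laplacian[OF u] blinfun_trace_scaleR)
  have u_pos: "u x > 0" for x using k(1) \<phi>_pos by (simp add: u_def)
  have u_gt: "u x > g x" if "x \<in> frontier \<Omega>" for x
  proof -
    have "g x \<le> B" using B that by auto
    also have "B < k * c" using k(2) c(1) by (simp add: field_simps)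
    also have "\<dots> \<le> u x" using c(2) that fr(1) k(1) by (simp add: u_def)
    finally show ?thesis .
  qed
  have super: "l * m x * u x - a x * f x (u x) \<le> - laplacian u x" if x: "x \<in> \<Omega>" for x
  proof -
    have xc: "x \<in> closure \<Omega>" using x fr by auto
    have "l * m x * u x \<le> M * u x"
      using M[OF xc] u_pos[of x] by (intro mult_right_mono) auto
    moreover have "k * F x \<le> a x * f x (u x)"
    proof (cases "x \<in> K")
      case True
      have f: "k * (B1 / a0) \<le> f x (u x)"
      proof -
        have "k * (B1 / a0) \<le> f x (k * c)" using k(1) k(3)[OF x] by (simp add: field_simps)
        also have "\<dots> \<le> f x (u x)"
          using k(1) c xc assms(15)
          by (intro mono_of_deriv_pos[OF assms(13) xc]) (auto simp: u_def)
        finally show ?thesis .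
      qed
      have "k * F x \<le> k * B1" using B1[OF xc] k(1) by simp
      also have "\<dots> = a0 * (k * (B1 / a0))" using a0(1) by simp
      also have "\<dots> \<le> a0 * f x (u x)" using f a0(1) by (intro mult_left_mono) auto
      also have "\<dots> \<le> a x * f x (u x)"
        using a0(2)[OF True] assms(15) xc u_pos[of x] by (intro mult_right_mono) (auto intro: less_imp_le)
      finally show ?thesis .
    next
      case False
      then have "k * F x \<le> 0" using xc k(1) by (simp add: K_def mult_le_0_iff)
      also have "0 \<le> a x * f x (u x)"
        using assms(6,15) xc u_pos[of x] by (simp add: less_imp_le)
      finally show ?thesis .
    qed
    ultimately show ?thesis by (simp add: lap F_def u_def algebra_simps)
  qed
  have "laplacian (\<lambda>x::'a. 0) x = 0" for x
    by (simp add: jet2_laplacian[OF jet2_const] blinfun_trace_def)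
  then have "subsolution \<Omega> l m a f g (\<lambda>x. 0)"
    unfolding subsolution_def
    using jet2_C2_closure[OF jet2_const] assms(11,14) fr(1) by auto
  moreover have "strict_supersolution \<Omega> l m a f g u"
    unfolding strict_supersolution_def supersolution_def
    using jet2_C2_closure[OF u] super u_gt assms(12) u_pos by (fastforce intro: less_imp_le)
  ultimately show "\<exists>u_sub u_sup. subsolution \<Omega> l m a f g u_sub \<and>
      strict_supersolution \<Omega> l m a f g u_sup \<and>
      (\<forall>x\<in>\<Omega>. u_sup x > 0) \<and> (\<forall>x\<in>\<Omega>. u_sub x < u_sup x)"
    using u_pos by blast
qed

end
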